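(* Let $\alpha=[0;a_1,a_2,a_3,\dots]$ be the continued fraction expansion of the irrational number $\alpha\in[0,1]$, with best approximation denominators $q_0=1,q_1,q_2,\dots$. Let $N\in\mathbb N$ be given, $N\ge1$, and denote its Ostrowski expansion by $$N=b_lq_l+b_{l-1}q_{l-1}+\cdots+b_1q_1+b_0,$$ where $l=l(N)$ is the unique integer such that $q_l\le N<q_{l+1}$, and where $b_i\in\{0,1,\dots,a_{i+1}\}$. Then $$\prod_{n=1}^N|2\sin(\pi n\alpha)|\le\prod_{i=0}^l 2^{b_i}q_i^3.$$
   Context: The best approximation denominators of $\alpha=[0;a_1,a_2,\dots]$ are the denominators of its convergents: $q_0=1$, $q_1=a_1$, $q_{i+1}=a_{i+1}q_i+q_{i-1}$ for $i\ge1$. The Ostrowski expansion of $N\ge 1$ with respect to $\alpha$ is the unique representation $N=\sum_{i=0}^l b_iq_i$ with integers $0\le b_0<a_1$, $0\le b_i\le a_{i+1}$ for $i\ge1$, and $b_{i-1}=0$ whenever $b_i=a_{i+1}$ ($i\ge 1$). *)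

theory Defs
  imports Complex_Main
begin

text \<open>The finite continued fraction \<open>[0; x\<^sub>1, \<dots>, x\<^sub>n]\<close> of a list \<open>[x\<^sub>1, \<dots>, x\<^sub>n]\<close>.\<close>

fun finite_cf :: "nat list \<Rightarrow> real" where
  "finite_cf [] = 0"
| "finite_cf (x # xs) = 1 / (real x + finite_cf xs)"

text \<open>
  \<open>\<alpha> = [0; a\<^sub>1, a\<^sub>2, \<dots>]\<close>, as the limit of \<open>[0; a\<^sub>1, \<dots>, a\<^sub>n]\<close>. Partial quotients are
  indexed from 1; the value \<open>a 0\<close> is irrelevant.
\<close>

definition is_cf_expansion :: "(nat \<Rightarrow> nat) \<Rightarrow> real \<Rightarrow> bool" where
  "is_cf_expansion a \<alpha> \<longleftrightarrow>
     (\<forall>i\<ge>1. a i \<ge> 1) \<and> (\<lambda>n. finite_cf (map a [1..<Suc n])) \<longlonglongrightarrow> \<alpha>"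

fun cf_denom :: "(nat \<Rightarrow> nat) \<Rightarrow> nat \<Rightarrow> nat" where
  "cf_denom a 0 = 1"
| "cf_denom a (Suc 0) = a 1"
| "cf_denom a (Suc (Suc i)) = a (Suc (Suc i)) * cf_denom a (Suc i) + cf_denom a i"

text \<open>Only the digits \<open>b 0, \<dots>, b l\<close> matter; the values of \<open>b\<close> beyond \<open>l\<close> are unconstrained.\<close>

definition is_ostrowski_expansion ::
    "(nat \<Rightarrow> nat) \<Rightarrow> nat \<Rightarrow> nat \<Rightarrow> (nat \<Rightarrow> nat) \<Rightarrow> bool" where
  "is_ostrowski_expansion a N l b \<longleftrightarrow>
     N = (\<Sum>i=0..l. b i * cf_denom a i) \<and>
     b 0 < a 1 \<and>
     (\<forall>i\<in>{1..l}. b i \<le> a (i + 1)) \<and>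
     (\<forall>i\<in>{1..l}. b i = a (i + 1) \<longrightarrow> b (i - 1) = 0)"

end

(* Cut {1..N} into runs of consecutive integers, b_i of them of length q_i. On a run of length
   q = q_i, alpha is compared with its convergent p/q, with the error centred at the middle of the
   run. Since p is coprime to q, the unperturbed product is |2 sin (pi q x)| for some x by the
   factorisation of z^q - 1. The perturbation eta/q, with eta = 1/(2 b_i), costs the factor
   1 + eta/(k + v), or the mirrored one, at the k-th point (k + v)/q. The factors of the two points
   next to an integer are not bounded, but they are absorbed by 2 sin (pi v) <= 8 v (1 - v); the
   others are harmonic. So each run contributes at most 2 exp ((2 + H_{q-2})/b_i), and the b_i runs
   together at most 2^{b_i} exp (2 + H_{q-2}) <= 2^{b_i} q^3. The position of a run is irrelevant,
   hence so is the order of the runs. *)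

theory Submission
  imports Defs "HOL-Analysis.Complex_Transcendental" "HOL-Computational_Algebra.Polynomial"
begin

section \<open>Sine products over equidistant points, from roots of unity\<close>

text \<open>As polynomials in \<open>z\<close> both sides are monic of degree \<open>q\<close> and
  vanish at the \<open>q\<close> distinct roots of unity, so their difference has degree below
  \<open>q\<close> and too many zeros.\<close>

lemma prod_diff_roots_of_unity:
  fixes z :: complex
  assumes "q > 0"
  shows "(\<Prod>k<q. z - cis (2 * pi * real k / real q)) = z ^ q - 1"
proof -
  let ?w = "\<lambda>k. cis (2 * pi * real k / real q)"
  define A where "A = ?w ` {..<q}"
  have bij: "bij_betw ?w {..<q} {z. z ^ q = 1}"
    using Complex.bij_betw_roots_unity[OF assms] .
  have inj: "inj_on ?w {..<q}" and A: "A = {z. z ^ q = 1}"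
    using bij by (auto simp: bij_betw_def A_def)
  have deg: "degree (\<Prod>k<q. [:- ?w k, 1:]) = q"
    by (subst degree_prod_eq_sum_degree) auto
  have "(\<Prod>k<q. [:- ?w k, 1:]) = monom 1 q - 1"
  proof (rule poly_eqI_degree_lead_coeff[where n = q and A = A])
    have "lead_coeff (\<Prod>k<q. [:- ?w k, 1:]) = 1"
      by (simp add: lead_coeff_prod)
    then show "coeff (\<Prod>k<q. [:- ?w k, 1:]) q = coeff (monom 1 q - 1) q"
      using deg assms by (simp add: coeff_1)
    show "q \<le> card A"
      unfolding A_def using inj by (simp add: card_image)
    show "degree (monom 1 q - 1 :: complex poly) \<le> q"
      by (intro degree_diff_le degree_monom_le) simp
    show "poly (\<Prod>k<q. [:- ?w k, 1:]) x = poly (monom 1 q - 1) x" if "x \<in> A" for x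
    proof -
      have "x ^ q = 1" using that A by simp
      moreover have "\<exists>k\<in>{..<q}. x = ?w k" using that by (auto simp: A_def)
      ultimately show ?thesis by (auto simp: poly_prod poly_monom)
    qed
  qed (simp add: deg)
  then have "poly (\<Prod>k<q. [:- ?w k, 1:]) z = poly (monom 1 q - 1) z"
    by simp
  then show ?thesis
    by (simp add: poly_prod poly_monom)
qed

lemma norm_1_minus_cis: "norm (1 - cis (2 * t)) = \<bar>2 * sin t\<bar>"
proof -
  have "(norm (1 - cis (2 * t)))\<^sup>2 = (2 * sin t)\<^sup>2"
  proof -
    have "(norm (1 - cis (2 * t)))\<^sup>2 = (1 - cos (2 * t))\<^sup>2 + (sin (2 * t))\<^sup>2"
      by (simp add: cmod_power2)
    also have "\<dots> = (2 * (sin t)\<^sup>2)\<^sup>2 + (2 * sin t * cos t)\<^sup>2"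
      unfolding cos_double_sin sin_double by simp
    also have "\<dots> = 4 * (sin t)\<^sup>2 * ((sin t)\<^sup>2 + (cos t)\<^sup>2)"
      by (simp only: power_mult_distrib) (simp add: power2_eq_square distrib_left)
    finally show ?thesis by (simp add: power_mult_distrib)
  qed
  then show ?thesis
    by (subst power2_eq_iff_nonneg[symmetric]) simp_all
qed

text \<open>Each factor is the distance from \<open>cis (- (2 * pi * x))\<close> to a
  \<open>q\<close>-th root of unity, so the product collapses to the norm of
  \<open>z ^ q - 1\<close>.\<close>

lemma prod_sin_equidistant:
  assumes "q > 0"
  shows "(\<Prod>k<q. \<bar>2 * sin (pi * (x + real k / real q))\<bar>) = \<bar>2 * sin (pi * (real q * x))\<bar>"
proof -
  let ?z = "cis (- (2 * pi * x))"
  have "(\<Prod>k<q. \<bar>2 * sin (pi * (x + real k / real q))\<bar>)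
      = (\<Prod>k<q. norm (?z - cis (2 * pi * real k / real q)))"
  proof (rule prod.cong)
    fix k
    let ?t = "pi * (x + real k / real q)"
    have "?z - cis (2 * pi * real k / real q) = ?z * (1 - cis (2 * ?t))"
      by (simp add: right_diff_distrib cis_mult algebra_simps)
    then show "\<bar>2 * sin ?t\<bar> = norm (?z - cis (2 * pi * real k / real q))"
      by (simp add: norm_mult norm_1_minus_cis)
  qed simp
  also have "\<dots> = norm (?z ^ q - 1)"
    by (simp add: prod_norm prod_diff_roots_of_unity[OF assms])
  also have "\<dots> = norm (1 - cis (2 * (- (pi * (real q * x)))))"
    by (subst Complex.DeMoivre, subst norm_minus_commute) (simp add: mult_ac)
  finally show ?thesis
    by (simp only: norm_1_minus_cis) simp
qed

section \<open>Elementary estimates for sine, cosine and the exponential\<close>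

text \<open>With \<open>w\<close> the distance from \<open>v\<close> to 1/2, the left side is
  \<open>1 - 2 * (sin (pi * w / 2))^2\<close> and the right side is \<open>1 - 4 * w^2\<close>, so a
  linear lower bound for sine suffices.\<close>

lemma sin_pi_le_parabola:
  assumes "0 \<le> v" "v \<le> 1"
  shows "sin (pi * v) \<le> 4 * v * (1 - v)"
proof -
  define w where "w = \<bar>v - 1/2\<bar>"
  have w: "0 \<le> w" "w \<le> 1/2"
    using assms by (auto simp: w_def abs_if)
  have conv: "convex_on {0..pi} (\<lambda>x. - sin x)"
    by (rule f''_ge0_imp_convex[where f' = "\<lambda>x. - cos x" and f'' = sin])
       (auto intro!: derivative_eq_intros sin_ge_zero)
  \<comment> \<open>Concavity puts sine above its chord from 0 to \<open>pi / 4\<close>; the point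
    \<open>pi * w / 2\<close> sits at parameter \<open>2 * w\<close>.\<close>
  have "- sin ((1 - 2 * w) *\<^sub>R 0 + (2 * w) *\<^sub>R (pi / 4)) \<le> (1 - 2 * w) * - sin 0 + 2 * w * - sin (pi / 4)"
    by (rule convex_onD[OF conv]) (use w in auto)
  then have "sqrt 2 * w \<le> sin (pi * w / 2)"
    by (simp add: sin_45 mult_ac)
  then have "(sqrt 2 * w)\<^sup>2 \<le> (sin (pi * w / 2))\<^sup>2"
    using w by (intro power_mono) auto
  then have "2 * w\<^sup>2 \<le> (sin (pi * w / 2))\<^sup>2"
    by (simp add: power_mult_distrib)
  moreover have "cos (pi * w) = 1 - 2 * (sin (pi * w / 2))\<^sup>2"
    using cos_double_sin[of "pi * w / 2"] by simp
  moreover have "sin (pi * v) = cos (pi * w)"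
  proof -
    have "sin (pi * v) = cos (pi * (v - 1/2))"
      by (simp add: right_diff_distrib cos_diff)
    also have "\<dots> = cos (pi * w)"
      unfolding w_def abs_if by (simp add: algebra_simps) (metis cos_minus minus_diff_eq)
    finally show ?thesis .
  qed
  moreover have "w\<^sup>2 = (v - 1/2)\<^sup>2"
    by (simp add: w_def)
  ultimately show ?thesis
    by (simp add: power2_eq_square algebra_simps)
qed

text \<open>The difference \<open>sin x - x * cos x\<close> vanishes at 0 and has derivative
  \<open>x * sin x\<close>, nonnegative on this interval.\<close>

lemma mult_cos_le_sin:
  assumes "0 \<le> x" "x \<le> pi"
  shows "x * cos x \<le> sin x"
proof -
  have "sin 0 - 0 * cos 0 \<le> sin x - x * cos x"
    by (rule DERIV_nonneg_imp_nondecreasing[OF assms(1)], rule exI, rule conjI,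
        (rule derivative_eq_intros refl)+)
       (use assms in \<open>auto intro!: mult_nonneg_nonneg sin_ge_zero\<close>)
  then show ?thesis by simp
qed

text \<open>A bound for \<open>pi * \<bar>cot (pi * c)\<bar>\<close>, cleared of its denominator.
  The two signs of the cosine come from \<open>mult_cos_le_sin\<close> at \<open>pi * c\<close> and
  at \<open>pi * (1 - c)\<close>.\<close>

lemma abs_cos_pi_le:
  assumes "0 < c" "c < 1" "1/c \<le> r" "1/(1-c) \<le> r"
  shows "pi * \<bar>cos (pi * c)\<bar> \<le> sin (pi * c) * r"
proof -
  have s: "0 \<le> sin (pi * c)"
    using assms by (intro sin_ge_zero) auto
  have "pi * cos (pi * c) \<le> sin (pi * c) * (1 / c)"
    using mult_cos_le_sin[of "pi * c"] assms by (simp add: field_simps)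
  also have "\<dots> \<le> sin (pi * c) * r"
    using assms s by (intro mult_left_mono) auto
  finally have 1: "pi * cos (pi * c) \<le> sin (pi * c) * r" .
  have "pi * (1 - c) * cos (pi * (1 - c)) \<le> sin (pi * (1 - c))"
    using assms by (intro mult_cos_le_sin) auto
  then have "pi * - cos (pi * c) \<le> sin (pi * c) * (1 / (1 - c))"
    using assms by (simp add: right_diff_distrib[of pi] cos_diff sin_diff field_simps)
  also have "\<dots> \<le> sin (pi * c) * r"
    using assms s by (intro mult_left_mono) auto
  finally show ?thesis
    using 1 by (auto simp: abs_if)
qed

text \<open>The cosine is kept rather than bounded by 1, so that relative to the sine the error is a
  cotangent, which \<open>abs_cos_pi_le\<close> controls.\<close>

lemma abs_sin_add_le:
  "\<bar>sin (pi * (c + d))\<bar> \<le> \<bar>sin (pi * c)\<bar> + pi * \<bar>d\<bar> * \<bar>cos (pi * c)\<bar>"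
proof -
  have "\<bar>sin (pi * (c + d))\<bar> \<le> \<bar>sin (pi * c) * cos (pi * d)\<bar> + \<bar>cos (pi * c) * sin (pi * d)\<bar>"
    by (simp add: distrib_left sin_add)
  also have "\<dots> \<le> \<bar>sin (pi * c)\<bar> * 1 + \<bar>cos (pi * c)\<bar> * \<bar>pi * d\<bar>"
    unfolding abs_mult[of "sin _"] abs_mult[of "cos _"]
    by (intro add_mono mult_left_mono abs_sin_x_le_abs_x abs_cos_le_one) auto
  finally show ?thesis
    by (simp add: abs_mult mult_ac)
qed

text \<open>This is where the cube arises, with \<open>m + 2\<close> in the role of the run length.
  The induction starts from \<open>exp 2 < 8\<close> and compares \<open>exp (1 / (m + 1))\<close>
  with the cube of \<open>(m + 3) / (m + 2)\<close>.\<close>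

lemma exp_harmonic_le_cube: "exp (2 + (\<Sum>k<m. 1 / real (k + 1))) \<le> real (m + 2) ^ 3"
proof (induction m)
  case 0
  have "exp (2::real) = exp 1 ^ 2"
    by (simp add: exp_of_nat_mult[symmetric])
  also have "\<dots> \<le> (272/100) ^ 2"
    using e_less_272 by (intro power_mono) auto
  finally show ?case by (simp add: power2_eq_square)
next
  case (Suc m)
  \<comment> \<open>The bound \<open>exp (1 / (m + 1)) \<le> (m + 1) / m\<close> degenerates at
    \<open>m = 0\<close>; there \<open>exp 1 \<le> 3\<close> gives 24 against 27.\<close>
  have step: "exp (1 / real (m + 1)) * real (m + 2) ^ 3 \<le> real (m + 3) ^ 3"
  proof (cases "m = 0")
    case True
    then show ?thesis using exp_le by simp
  next
    case False
    have "1 - 1 / real (m + 1) \<le> exp (- (1 / real (m + 1)))"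
      using exp_ge_add_one_self[of "- (1 / real (m + 1))"] by simp
    then have "exp (1 / real (m + 1)) \<le> real (m + 1) / real m"
      using False by (simp add: exp_minus field_simps)
    then have "exp (1 / real (m + 1)) * real (m + 2) ^ 3 \<le> real (m + 1) / real m * real (m + 2) ^ 3"
      by (intro mult_right_mono) auto
    also have "\<dots> \<le> real (m + 3) ^ 3"
    proof -
      have "(m + 1) * (m + 2) ^ 3 \<le> m * (m + 3) ^ 3"
        using False by (cases m) (auto simp: power3_eq_cube algebra_simps)
      then have "real (m + 1) * real (m + 2) ^ 3 \<le> real m * real (m + 3) ^ 3"
        by (metis of_nat_le_iff of_nat_mult of_nat_power)
      then show ?thesis using False by (simp add: field_simps)
    qed
    finally show ?thesis .
  qed
  have "exp (2 + (\<Sum>k<Suc m. 1 / real (k + 1)))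
      = exp (1 / real (m + 1)) * exp (2 + (\<Sum>k<m. 1 / real (k + 1)))"
    by (simp add: exp_add[symmetric] add_ac)
  also have "\<dots> \<le> exp (1 / real (m + 1)) * real (m + 2) ^ 3"
    using Suc by (intro mult_left_mono) auto
  also note step
  finally show ?case by (simp add: add_ac numeral_3_eq_3)
qed

section \<open>The perturbed product over one full set of equidistant points\<close>

text \<open>Factoring out the sines leaves \<open>1 + \<eta> * r k\<close>, where \<open>r k\<close>
  bounds the cotangent divided by \<open>q\<close>. The sines multiply to
  \<open>2 * sin (pi * v)\<close>, which tames the two end factors; the inner ones are bounded by
  exponentials.\<close>

lemma prod_perturbed_sin_le:
  fixes x \<eta> :: real
  assumes q: "q = m + 2" and x: "0 < x" "x < 1 / real q" and \<eta>: "0 \<le> \<eta>"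
  shows "(\<Prod>k<q. 2 * (\<bar>sin (pi * (x + real k / real q))\<bar>
                      + pi * (\<eta> / real q) * \<bar>cos (pi * (x + real k / real q))\<bar>))
       \<le> 2 * (1 + 2 * \<eta>)\<^sup>2 * exp (2 * \<eta> * (\<Sum>k<m. 1 / real (k + 1)))"
    (is "(\<Prod>k<q. ?g k) \<le> _")
proof -
  define v where "v = real q * x"
  have v: "0 < v" "v < 1"
    using x q by (auto simp: v_def pos_less_divide_eq mult.commute)
  have xv: "x = v / real q"
    using q by (simp add: v_def)
  \<comment> \<open>\<open>r k\<close> must dominate both \<open>1 / (v + k)\<close> and
    \<open>1 / (q - k - v)\<close>. At the ends the possibly huge reciprocal is kept exactly;
    inside, a sum free of \<open>v\<close> splits into two harmonic sums.\<close>
  define r where "r k = (if k = 0 then 1 / v else if k = m + 1 then 1 / (1 - v)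
      else 1 / real k + 1 / real (m + 1 - k))" for k
  have rpos: "0 \<le> r k" for k
    using v by (auto simp: r_def)
  have bound: "?g k \<le> \<bar>2 * sin (pi * (x + real k / real q))\<bar> * (1 + \<eta> * r k)" if kq: "k < q" for k
  proof -
    let ?c = "x + real k / real q"
    have c: "?c = (v + real k) / real q"
      by (simp add: xv add_divide_distrib)
    have k: "real k \<le> real m + 1"
      using kq q by simp
    have c01: "0 < ?c" "?c < 1"
      using kq q v k unfolding c by (auto simp: field_simps)
    have c1: "1 / ?c = real q / (v + real k)"
      unfolding c by simp
    have "1 - ?c = (real q - real k - v) / real q"
      unfolding c using q by (simp add: field_simps)
    then have c2: "1 / (1 - ?c) = real q / (real q - real k - v)"
      by simp
    have r: "1 / (v + real k) \<le> r k \<and> 1 / (real q - real k - v) \<le> r k"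
    proof -
      consider "k = 0" | "k = m + 1" | "k \<noteq> 0" "k < m + 1"
        using kq q by linarith
      then show ?thesis
      proof cases
        case 1
        then have "1 / (real q - v) \<le> 1 / v"
          using v q by (intro divide_left_mono) auto
        then show ?thesis using 1 by (simp add: r_def)
      next
        case 2
        then have "1 / (v + real k) \<le> 1 / (1 - v)"
          using v by (intro divide_left_mono) auto
        then show ?thesis using 2 q by (simp add: r_def)
      next
        case 3
        have "1 / (v + real k) \<le> 1 / real k"
          using 3 v by (intro divide_left_mono) auto
        moreover have "1 / (real q - real k - v) \<le> 1 / real (m + 1 - k)"
          using 3 v q by (intro divide_left_mono mult_pos_pos) (auto simp: of_nat_diff)
        moreover have "0 \<le> 1 / real k" "0 \<le> 1 / real (m + 1 - k)"
          by auto
        moreover have "r k = 1 / real k + 1 / real (m + 1 - k)"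
          using 3 by (simp add: r_def)
        ultimately show ?thesis
          by (metis add_increasing add_increasing2)
      qed
    qed
    have "real q * (1 / (v + real k)) \<le> real q * r k"
      "real q * (1 / (real q - real k - v)) \<le> real q * r k"
      using r by (intro mult_left_mono; simp)+
    then have "pi * \<bar>cos (pi * ?c)\<bar> \<le> sin (pi * ?c) * (real q * r k)"
      using c01 by (intro abs_cos_pi_le) (simp_all only: c1 c2, simp_all)
    then have "(\<eta> / real q) * (pi * \<bar>cos (pi * ?c)\<bar>) \<le> (\<eta> / real q) * (sin (pi * ?c) * (real q * r k))"
      using \<eta> by (intro mult_left_mono) auto
    also have "\<dots> = sin (pi * ?c) * (\<eta> * r k)"
      using q by simp
    finally have "pi * (\<eta> / real q) * \<bar>cos (pi * ?c)\<bar> \<le> sin (pi * ?c) * (\<eta> * r k)"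
      by (simp add: mult_ac)
    moreover have "0 \<le> sin (pi * ?c)"
      using c01 by (intro sin_ge_zero) auto
    ultimately show ?thesis
      by (simp only: abs_mult abs_of_nonneg distrib_left)
  qed
  have "(\<Prod>k<q. ?g k) \<le> (\<Prod>k<q. \<bar>2 * sin (pi * (x + real k / real q))\<bar> * (1 + \<eta> * r k))"
    using bound \<eta> by (intro prod_mono) auto
  also have "\<dots> = \<bar>2 * sin (pi * v)\<bar> * (\<Prod>k<q. 1 + \<eta> * r k)"
    using q by (simp only: prod.distrib v_def, subst prod_sin_equidistant) auto
  also have "(\<Prod>k<q. 1 + \<eta> * r k) = (1 + \<eta> / v) * (1 + \<eta> / (1 - v)) * (\<Prod>k<m. 1 + \<eta> * r (Suc k))"
  proof -
    have "r 0 = 1 / v" "r (Suc m) = 1 / (1 - v)"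
      by (simp_all add: r_def)
    then show ?thesis
      unfolding q add_2_eq_Suc' by (subst prod.lessThan_Suc_shift) (simp add: mult_ac)
  qed
  also have "\<bar>2 * sin (pi * v)\<bar> * \<dots>
      \<le> (2 * (1 + 2 * \<eta>)\<^sup>2) * exp (2 * \<eta> * (\<Sum>k<m. 1 / real (k + 1)))"
    unfolding mult.assoc[symmetric]
  proof (rule mult_mono)
    have s: "0 \<le> sin (pi * v)"
      using v by (intro sin_ge_zero) auto
    \<comment> \<open>Since \<open>1 / v + 1 / (1 - v) = 1 / (v * (1 - v))\<close>, both poles merge
      into the one that the parabola bound cancels.\<close>
    have "sin (pi * v) * ((1 + \<eta> / v) * (1 + \<eta> / (1 - v)))
        = sin (pi * v) + (\<eta> + \<eta>\<^sup>2) * (sin (pi * v) / (v * (1 - v)))"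
      using v by (simp add: divide_simps power2_eq_square) (simp add: algebra_simps)
    also have "\<dots> \<le> 1 + (\<eta> + \<eta>\<^sup>2) * 4"
      using sin_pi_le_parabola[of v] v \<eta>
      by (intro add_mono mult_left_mono) (auto simp: field_simps)
    also have "\<dots> = (1 + 2 * \<eta>)\<^sup>2"
      by (simp add: power2_eq_square algebra_simps)
    finally show "\<bar>2 * sin (pi * v)\<bar> * (1 + \<eta> / v) * (1 + \<eta> / (1 - v)) \<le> 2 * (1 + 2 * \<eta>)\<^sup>2"
      using s by (simp add: abs_mult mult_ac)
    have "(\<Prod>k<m. 1 + \<eta> * r (Suc k)) \<le> (\<Prod>k<m. exp (\<eta> * r (Suc k)))"
      using \<eta> rpos by (intro prod_mono conjI exp_ge_add_one_self add_nonneg_nonneg mult_nonneg_nonneg) auto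
    also have "\<dots> = exp (\<eta> * (\<Sum>k<m. r (Suc k)))"
      by (simp add: exp_sum sum_distrib_left)
    \<comment> \<open>The second summand, \<open>1 / (m - k)\<close>, is written with
      \<open>m - Suc k + 1\<close> to match the reversal of the summation order.\<close>
    also have "(\<Sum>k<m. r (Suc k)) = (\<Sum>k<m. 1 / real (k + 1)) + (\<Sum>k<m. 1 / real (m - Suc k + 1))"
      unfolding sum.distrib[symmetric]
      by (intro sum.cong) (auto simp: r_def Suc_diff_Suc)
    also have "(\<Sum>k<m. 1 / real (m - Suc k + 1)) = (\<Sum>k<m. 1 / real (k + 1))"
      by (rule sum.nat_diff_reindex)
    finally show "(\<Prod>k<m. 1 + \<eta> * r (Suc k)) \<le> exp (2 * \<eta> * (\<Sum>k<m. 1 / real (k + 1)))"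
      by (simp add: mult_ac)
    show "0 \<le> (\<Prod>k<m. 1 + \<eta> * r (Suc k))"
      using \<eta> rpos by (intro prod_nonneg) auto
  qed auto
  finally show ?thesis .
qed

section \<open>One run of consecutive integers, and repetition of runs\<close>

lemma abs_sin_cos_pi_add_int:
  "\<bar>sin (pi * (t + of_int j))\<bar> = \<bar>sin (pi * t)\<bar>" "\<bar>cos (pi * (t + of_int j))\<bar> = \<bar>cos (pi * t)\<bar>"
  by (simp_all add: distrib_left sin_add cos_add)

text \<open>Used to reorder a run into equidistant points. Invertibility of \<open>p\<close> modulo
  \<open>q\<close> gives injectivity, and counting does the rest.\<close>

lemma bij_betw_affine_mod:
  fixes p j :: int
  assumes "q > 0" "coprime p (int q)"
  shows "bij_betw (\<lambda>n. nat ((int n * p + j) mod int q)) {1..q} {..<q}"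
proof -
  let ?f = "\<lambda>n. nat ((int n * p + j) mod int q)"
  have inj: "inj_on ?f {1..q}"
  proof (rule inj_onI)
    fix n n' assume n: "n \<in> {1..q}" "n' \<in> {1..q}" and eq: "?f n = ?f n'"
    have "(int n * p + j) mod int q = (int n' * p + j) mod int q"
      using eq assms(1) by (subst (asm) eq_nat_nat_iff) simp_all
    then have "int q dvd (int n * p + j) - (int n' * p + j)"
      by (simp add: mod_eq_dvd_iff)
    then have "int q dvd (int n - int n') * p"
      by (simp add: algebra_simps)
    moreover have "coprime (int q) p"
      using assms(2) by (rule coprime_commute[THEN iffD1])
    ultimately have dvd: "int q dvd int n - int n'"
      by (simp only: coprime_dvd_mult_left_iff)
    show "n = n'"
    proof (rule ccontr)
      assume "n \<noteq> n'"
      then have "\<bar>int q\<bar> \<le> \<bar>int n - int n'\<bar>"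
        using dvd by (intro dvd_imp_le_int) auto
      then show False using n by auto
    qed
  qed
  moreover have "?f ` {1..q} = {..<q}"
  proof (rule card_subset_eq)
    show "?f ` {1..q} \<subseteq> {..<q}"
      using assms(1) by (auto simp: nat_less_iff)
  qed (use inj in \<open>simp_all add: card_image\<close>)
  ultimately show ?thesis
    by (simp add: bij_betw_def)
qed

text \<open>The offset \<open>M\<close> enters only through the base point \<open>X\<close>, hence
  the uniform bound. Around \<open>X\<close> the points are \<open>n * p / q\<close> with error
  \<open>(n - (q + 1) / 2) * \<delta>\<close>.\<close>

lemma prod_sin_block_le:
  fixes \<alpha> :: real and p :: int
  assumes irr: "\<alpha> \<notin> \<rat>" and q: "q = m + 2" and cop: "coprime p (int q)" and b: "b > 0"
    and appr: "\<bar>\<alpha> - of_int p / real q\<bar> \<le> 1 / (real q ^ 2 * real b)"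
  shows "(\<Prod>n=1..q. \<bar>2 * sin (pi * real (M + n) * \<alpha>)\<bar>)
       \<le> 2 * exp ((2 + (\<Sum>k<m. 1 / real (k + 1))) / real b)"
proof -
  define \<delta> where "\<delta> = \<alpha> - of_int p / real q"
  \<comment> \<open>Chosen so that \<open>\<eta> / q\<close> is \<open>q / 2\<close>, the maximal
    distance allowed from the centre, times the bound on \<open>\<delta>\<close>.\<close>
  define \<eta> where "\<eta> = 1 / (2 * real b)"
  \<comment> \<open>\<open>(q + 1) / 2\<close> is the mean of 1, ..., \<open>q\<close>; centring
    there halves the worst error.\<close>
  define X where "X = real M * \<alpha> + (real q + 1) / 2 * \<delta>"
  define j where "j = \<lfloor>real q * X\<rfloor>"
  define x where "x = X - of_int j / real q"
  have qpos: "real q > 0" using q by simp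
  define g where "g t = 2 * (\<bar>sin (pi * t)\<bar> + pi * (\<eta> / real q) * \<bar>cos (pi * t)\<bar>)" for t
  have g_int: "g (t + of_int i) = g t" for t i
    by (simp add: g_def abs_sin_cos_pi_add_int)
  \<comment> \<open>Otherwise a linear equation with positive coefficient would make
    \<open>\<alpha>\<close> rational. This keeps \<open>x\<close> off the endpoint 0, where
    \<open>1 / v\<close> would blow up.\<close>
  have "real q * X \<noteq> of_int j"
  proof
    assume "real q * X = of_int j"
    moreover have "2 * (real q * X) = \<alpha> * (real q * (2 * real M + real q + 1)) - (real q + 1) * of_int p"
      using qpos by (simp add: X_def \<delta>_def field_simps)
    ultimately have "\<alpha> * (real q * (2 * real M + real q + 1)) = 2 * of_int j + (real q + 1) * of_int p"
      by linarith
    moreover have "real q * (2 * real M + real q + 1) > 0"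
      using qpos by simp
    ultimately have "\<alpha> = (2 * of_int j + (real q + 1) * of_int p) / (real q * (2 * real M + real q + 1))"
      by (simp add: field_simps)
    also have "\<dots> \<in> \<rat>"
      by (intro Rats_divide Rats_add Rats_mult) auto
    finally show False using irr by simp
  qed
  then have x: "0 < x" "x < 1 / real q"
  proof -
    assume "real q * X \<noteq> of_int j"
    then have frac: "0 < real q * X - of_int j" "real q * X - of_int j < 1"
      using of_int_floor_le[of "real q * X"] real_of_int_floor_add_one_gt[of "real q * X"]
      unfolding j_def by linarith+
    have "x = (real q * X - of_int j) / real q"
      using qpos by (simp add: x_def diff_divide_distrib)
    then show "0 < x" "x < 1 / real q"
      using frac qpos by (auto intro: divide_strict_right_mono)
  qed
  have "\<bar>2 * sin (pi * real (M + n) * \<alpha>)\<bar> \<le> g (x + real (nat ((int n * p + j) mod int q)) / real q)"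
    if n: "n \<in> {1..q}" for n
  proof -
    let ?c = "X + real n * of_int p / real q" and ?d = "(real n - (real q + 1) / 2) * \<delta>"
    have "\<bar>real n - (real q + 1) / 2\<bar> \<le> real q / 2"
      using n by (auto simp: abs_le_iff field_simps)
    then have "\<bar>?d\<bar> \<le> real q / 2 * (1 / (real q ^ 2 * real b))"
      unfolding abs_mult using appr by (intro mult_mono) (auto simp: \<delta>_def)
    also have "\<dots> = \<eta> / real q"
      using qpos by (simp add: \<eta>_def power2_eq_square)
    finally have d: "\<bar>?d\<bar> \<le> \<eta> / real q" .
    have "real (M + n) * \<alpha> = ?c + ?d"
      using qpos by (simp add: X_def \<delta>_def field_simps)
    then have "\<bar>sin (pi * real (M + n) * \<alpha>)\<bar> = \<bar>sin (pi * (?c + ?d))\<bar>"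
      by (simp only: mult.assoc)
    also have "\<dots> \<le> \<bar>sin (pi * ?c)\<bar> + pi * \<bar>?d\<bar> * \<bar>cos (pi * ?c)\<bar>"
      by (rule abs_sin_add_le)
    also have "\<dots> \<le> \<bar>sin (pi * ?c)\<bar> + pi * (\<eta> / real q) * \<bar>cos (pi * ?c)\<bar>"
      using d by (intro add_left_mono mult_right_mono mult_left_mono) auto
    finally have "\<bar>2 * sin (pi * real (M + n) * \<alpha>)\<bar> \<le> g ?c"
      by (simp add: g_def abs_mult)
    \<comment> \<open>Moving \<open>j\<close> into the residue puts the base point in the first
      interval of length \<open>1 / q\<close>; periodicity of \<open>g\<close> then discards the
      integer quotient.\<close>
    also have "?c = x + real_of_int (int n * p + j) / real q"
      using qpos by (simp add: x_def field_simps)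
    also have "real_of_int (int n * p + j) / real q
        = real_of_int ((int n * p + j) mod int q) / real q + of_int ((int n * p + j) div int q)"
    proof -
      have "real_of_int i = of_int (i div int q) * real q + of_int (i mod int q)" for i
        by (metis div_mult_mod_eq of_int_add of_int_mult of_int_of_nat_eq)
      from this[of "int n * p + j"] show ?thesis
        using qpos by (simp add: field_simps del: of_int_add of_int_mult)
    qed
    finally show ?thesis
      using g_int[of "x + real_of_int ((int n * p + j) mod int q) / real q"] qpos
      by (simp add: add.assoc)
  qed
  then have "(\<Prod>n=1..q. \<bar>2 * sin (pi * real (M + n) * \<alpha>)\<bar>)
      \<le> (\<Prod>n=1..q. g (x + real (nat ((int n * p + j) mod int q)) / real q))"
    by (intro prod_mono) auto
  also have "\<dots> = (\<Prod>k<q. g (x + real k / real q))"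
    using qpos cop by (intro prod.reindex_bij_betw bij_betw_affine_mod) auto
  also have "\<dots> \<le> 2 * (1 + 2 * \<eta>)\<^sup>2 * exp (2 * \<eta> * (\<Sum>k<m. 1 / real (k + 1)))"
    unfolding g_def by (rule prod_perturbed_sin_le[OF q x]) (simp add: \<eta>_def)
  \<comment> \<open>With \<open>2 * \<eta> = 1 / b\<close> the whole excess becomes an exponential
    whose exponent is a multiple of \<open>1 / b\<close>, ready for a \<open>b\<close>-th
    power.\<close>
  also have "\<dots> \<le> 2 * (exp (2 * \<eta>))\<^sup>2 * exp (2 * \<eta> * (\<Sum>k<m. 1 / real (k + 1)))"
    by (intro mult_right_mono mult_left_mono power_mono exp_ge_add_one_self) (auto simp: \<eta>_def)
  also have "\<dots> = 2 * exp ((2 + (\<Sum>k<m. 1 / real (k + 1))) / real b)"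
    by (simp add: power2_eq_square exp_add[symmetric] \<eta>_def add_divide_distrib mult.assoc)
  finally show ?thesis .
qed

lemma prod_blocks_le:
  fixes f :: "nat \<Rightarrow> real"
  assumes "\<And>n. 0 \<le> f n" and "\<And>M. (\<Prod>n=1..q. f (M + n)) \<le> B"
  shows "(\<Prod>n=1..b * q. f (M + n)) \<le> B ^ b"
proof (induction b)
  case (Suc b)
  have "(\<Prod>n=1..Suc b * q. f (M + n)) = (\<Prod>n=1..b * q. f (M + n)) * (\<Prod>n=b * q + 1..b * q + q. f (M + n))"
    using prod.ub_add_nat[of 1 "b * q" "\<lambda>n. f (M + n)" q] by (simp add: add.commute[of q])
  also have "(\<Prod>n=b * q + 1..b * q + q. f (M + n)) = (\<Prod>n=1..q. f ((M + b * q) + n))"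
    using prod.shift_bounds_cl_nat_ivl[of "\<lambda>n. f (M + n)" 1 "b * q" q] by (simp add: add_ac)
  also have "(\<Prod>n=1..b * q. f (M + n)) * \<dots> \<le> B ^ b * B"
  proof (rule mult_mono)
    \<comment> \<open>Any one block forces \<open>B\<close> to be nonnegative.\<close>
    have "0 \<le> (\<Prod>n=1..q. f (0 + n))"
      using assms by (intro prod_nonneg) auto
    then have "0 \<le> B" using assms(2)[of 0] by linarith
    then show "0 \<le> B ^ b" by simp
  qed (use assms Suc in \<open>auto intro: prod_nonneg\<close>)
  finally show ?case by (simp add: mult.commute)
qed simp

section \<open>Convergents and their approximation error\<close>

fun cf_num :: "(nat \<Rightarrow> nat) \<Rightarrow> nat \<Rightarrow> nat" where
  "cf_num a 0 = 0"
| "cf_num a (Suc 0) = 1"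
| "cf_num a (Suc (Suc i)) = a (Suc (Suc i)) * cf_num a (Suc i) + cf_num a i"

text \<open>\<open>finite_cf\<close> unfolds at the front of the list, while the recurrences extend
  at the back; this identity and \<open>cf_denom_Suc\<close> bridge the two.\<close>

lemma cf_num_Suc: "cf_num a (Suc n) = cf_denom (\<lambda>i. a (Suc i)) n"
  by (induction n rule: induct_nat_012) auto

lemma cf_denom_Suc:
  "cf_denom a (Suc n) = a 1 * cf_denom (\<lambda>i. a (Suc i)) n + cf_num (\<lambda>i. a (Suc i)) n"
  by (induction n rule: induct_nat_012) (auto simp: algebra_simps)

lemma cf_denom_pos:
  assumes "\<And>i. i \<ge> 1 \<Longrightarrow> a i \<ge> 1"
  shows "cf_denom a n > 0"
  using assms[of "Suc _"] by (induction n rule: induct_nat_012) (auto simp: Suc_le_eq)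

lemma finite_cf_eq:
  assumes "\<And>i. i \<ge> 1 \<Longrightarrow> a i \<ge> 1"
  shows "finite_cf (map a [1..<Suc n]) = real (cf_num a n) / real (cf_denom a n)"
  using assms
proof (induction n arbitrary: a)
  case (Suc n)
  let ?a = "\<lambda>i. a (Suc i)"
  have pos: "cf_denom ?a n > 0" using Suc.prems by (intro cf_denom_pos) auto
  have "map a [1..<Suc (Suc n)] = a 1 # map ?a [1..<Suc n]"
    by (simp add: upt_conv_Cons map_Suc_upt[symmetric] del: upt_Suc)
  then have "finite_cf (map a [1..<Suc (Suc n)]) = 1 / (real (a 1) + real (cf_num ?a n) / real (cf_denom ?a n))"
    using Suc.IH[of ?a] Suc.prems by simp
  also have "\<dots> = real (cf_denom ?a n) / real (cf_denom a (Suc n))"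
    using pos by (simp add: cf_denom_Suc field_simps)
  finally show ?case by (simp add: cf_num_Suc)
qed simp

lemma cf_det:
  "int (cf_num a (Suc n)) * int (cf_denom a n) - int (cf_num a n) * int (cf_denom a (Suc n)) = (- 1) ^ n"
  by (induction n rule: induct_nat_012) (auto simp: algebra_simps)

text \<open>A common divisor divides the determinant in \<open>cf_det\<close>, which is a
  unit.\<close>

lemma coprime_cf: "coprime (int (cf_num a n)) (int (cf_denom a n))"
proof (rule coprimeI)
  fix c assume "c dvd int (cf_num a n)" "c dvd int (cf_denom a n)"
  then have "c dvd int (cf_num a (Suc n)) * int (cf_denom a n) - int (cf_num a n) * int (cf_denom a (Suc n))"
    by (intro dvd_diff dvd_mult dvd_mult2)
  then have "c dvd (- 1) ^ n" by (simp only: cf_det)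
  then show "is_unit c" by (metis dvd_trans is_unit_power_iff minus_dvd_iff one_dvd dvd_refl)
qed

text \<open>In \<open>k\<close>, the signed cross difference obeys the recurrence of the
  denominators with initial values 0 and 1. Multiplied by \<open>cf_denom a (Suc n)\<close> it
  therefore stays below \<open>cf_denom a (n + k)\<close>, which starts at least as high.\<close>

lemma cf_cross:
  "0 \<le> (- 1) ^ n * (int (cf_num a (n + k)) * int (cf_denom a n) - int (cf_num a n) * int (cf_denom a (n + k)))
   \<and> (- 1) ^ n * (int (cf_num a (n + k)) * int (cf_denom a n) - int (cf_num a n) * int (cf_denom a (n + k)))
       * int (cf_denom a (Suc n)) \<le> int (cf_denom a (n + k))"
    (is "0 \<le> ?D k \<and> _")
proof (induction k rule: induct_nat_012)
  case 1
  then show ?case by (simp add: cf_det power_add[symmetric] mult_2[symmetric])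
next
  case (ge2 k)
  have "?D (Suc (Suc k)) = int (a (Suc (Suc (n + k)))) * ?D (Suc k) + ?D k"
    by (simp add: algebra_simps)
  moreover have "int (cf_denom a (n + Suc (Suc k)))
      = int (a (Suc (Suc (n + k)))) * int (cf_denom a (n + Suc k)) + int (cf_denom a (n + k))"
    by simp
  moreover have "int (a (Suc (Suc (n + k)))) * (?D (Suc k) * int (cf_denom a (Suc n)))
      \<le> int (a (Suc (Suc (n + k)))) * int (cf_denom a (n + Suc k))"
    using ge2 by (intro mult_left_mono) auto
  moreover have "0 \<le> int (a (Suc (Suc (n + k)))) * ?D (Suc k)"
    by (rule mult_nonneg_nonneg) (use ge2 in auto)
  ultimately show ?case
    using ge2 by (simp only: distrib_right mult.assoc) linarith
qed simp

text \<open>Dividing \<open>cf_cross\<close> by the denominators bounds the distance between the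
  \<open>n\<close>-th and every later convergent, and the bound survives the limit.\<close>

lemma cf_approximation:
  assumes "is_cf_expansion a \<alpha>"
  shows "\<bar>\<alpha> - real (cf_num a n) / real (cf_denom a n)\<bar> \<le> 1 / (real (cf_denom a n) * real (cf_denom a (Suc n)))"
proof -
  let ?p = "\<lambda>i. real (cf_num a i)" and ?q = "\<lambda>i. real (cf_denom a i)"
  have a: "\<And>i. i \<ge> 1 \<Longrightarrow> a i \<ge> 1" and lim: "(\<lambda>n. finite_cf (map a [1..<Suc n])) \<longlonglongrightarrow> \<alpha>"
    using assms by (auto simp: is_cf_expansion_def)
  have pos: "?q i > 0" for i
    using cf_denom_pos[OF a] by simp
  have "(\<lambda>i. ?p i / ?q i) \<longlonglongrightarrow> \<alpha>"
    using lim by (simp only: finite_cf_eq[OF a])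
  then have "(\<lambda>i. \<bar>?p i / ?q i - ?p n / ?q n\<bar>) \<longlonglongrightarrow> \<bar>\<alpha> - ?p n / ?q n\<bar>"
    by (intro tendsto_intros)
  moreover have "\<bar>?p i / ?q i - ?p n / ?q n\<bar> \<le> 1 / (?q n * ?q (Suc n))" if "i \<ge> n" for i
  proof -
    obtain k where i: "i = n + k" using \<open>i \<ge> n\<close> le_Suc_ex by blast
    define D where "D = int (cf_num a i) * int (cf_denom a n) - int (cf_num a n) * int (cf_denom a i)"
    have "0 \<le> (- 1) ^ n * D" "(- 1) ^ n * D * int (cf_denom a (Suc n)) \<le> int (cf_denom a i)"
      using cf_cross[of n a k] by (auto simp: D_def i)
    moreover have "\<bar>(- 1) ^ n * D\<bar> = \<bar>D\<bar>"
      by (simp add: abs_mult)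
    ultimately have "\<bar>D\<bar> * int (cf_denom a (Suc n)) \<le> int (cf_denom a i)"
      by simp
    then have "real_of_int (\<bar>D\<bar> * int (cf_denom a (Suc n))) \<le> real_of_int (int (cf_denom a i))"
      by (simp only: of_int_le_iff)
    then have "\<bar>real_of_int D\<bar> * ?q (Suc n) \<le> ?q i"
      by (simp only: of_int_mult of_int_abs of_int_of_nat_eq)
    moreover have "?p i / ?q i - ?p n / ?q n = real_of_int D / (?q i * ?q n)"
      using pos[of i] pos[of n] by (simp add: D_def field_simps)
    ultimately show ?thesis
      using pos[of i] pos[of n] pos[of "Suc n"] by (simp add: abs_mult field_simps)
  qed
  ultimately show ?thesis
    by (intro LIMSEQ_le_const2) auto
qed

section \<open>Assembling the runs of each level and then all levels\<close>

text \<open>For denominator 1, which includes \<open>i = 0\<close>, each factor is at most 2. For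
  \<open>b = 0\<close> the product is empty. Otherwise \<open>b\<close> runs are multiplied.\<close>

lemma prod_sin_level_le:
  assumes irr: "\<alpha> \<notin> \<rat>" and cf: "is_cf_expansion a \<alpha>" and b: "i = 0 \<or> b \<le> a (i + 1)"
  shows "(\<Prod>n=1..b * cf_denom a i. \<bar>2 * sin (pi * real (M + n) * \<alpha>)\<bar>) \<le> 2 ^ b * real (cf_denom a i) ^ 3"
proof -
  let ?q = "cf_denom a i"
  have pos: "?q > 0"
    using cf by (intro cf_denom_pos) (auto simp: is_cf_expansion_def)
  consider "?q = 1" | "b = 0" | "?q \<ge> 2" "b > 0" "b \<le> a (Suc i)"
    using b pos by (cases "i = 0"; cases "?q = 1"; cases "b = 0") auto
  then show ?thesis
  proof cases
    case 1
    have "(\<Prod>n=1..b * ?q. \<bar>2 * sin (pi * real (M + n) * \<alpha>)\<bar>) \<le> 2 ^ b"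
      by (rule prod_blocks_le) (auto simp: 1 abs_mult)
    then show ?thesis by (simp add: 1)
  next
    case 2
    then show ?thesis using pos by simp
  next
    case 3
    then obtain m where m: "?q = m + 2"
      by (metis add.commute le_Suc_ex)
    let ?S = "\<Sum>k<m. 1 / real (k + 1)"
    \<comment> \<open>The digit bound turns the convergent error \<open>1 / (q_i * q_(i+1))\<close>
      into the \<open>1 / (q_i^2 * b)\<close> required for a run.\<close>
    have "b * ?q \<le> a (Suc i) * ?q"
      using 3 by simp
    also have "\<dots> \<le> cf_denom a (Suc i)"
      by (cases i) auto
    finally have le: "real b * real ?q \<le> real (cf_denom a (Suc i))"
      by (metis of_nat_le_iff of_nat_mult)
    have "\<bar>\<alpha> - of_int (int (cf_num a i)) / real ?q\<bar> \<le> 1 / (real ?q * real (cf_denom a (Suc i)))"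
      using cf_approximation[OF cf, of i] by simp
    also have "\<dots> \<le> 1 / (real ?q * (real b * real ?q))"
      using 3 pos le by (intro divide_left_mono mult_left_mono mult_pos_pos less_le_trans[OF _ le]) auto
    finally have appr: "\<bar>\<alpha> - of_int (int (cf_num a i)) / real ?q\<bar> \<le> 1 / (real ?q ^ 2 * real b)"
      by (simp add: power2_eq_square mult_ac)
    have "(\<Prod>n=1..b * ?q. \<bar>2 * sin (pi * real (M + n) * \<alpha>)\<bar>) \<le> (2 * exp ((2 + ?S) / real b)) ^ b"
      by (rule prod_blocks_le)
         (simp, rule prod_sin_block_le[OF irr m coprime_cf \<open>b > 0\<close> appr])
    \<comment> \<open>The \<open>b\<close>-th power cancels the \<open>1 / b\<close> in the
      exponent, so the exponential is paid only once per level.\<close>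
    also have "\<dots> = 2 ^ b * exp (2 + ?S)"
      using 3 by (simp add: power_mult_distrib exp_of_nat_mult[symmetric])
    also have "\<dots> \<le> 2 ^ b * real ?q ^ 3"
      unfolding m by (intro mult_left_mono exp_harmonic_le_cube) auto
    finally show ?thesis .
  qed
qed

text \<open>Levels are placed in increasing order, so level \<open>k\<close> appends a final segment
  with offset \<open>?M\<close>, where the bound of \<open>prod_sin_level_le\<close> holds for any
  offset.\<close>

lemma prod_sin_digits_le:
  assumes irr: "\<alpha> \<notin> \<rat>" and cf: "is_cf_expansion a \<alpha>" and b: "\<forall>i\<in>{1..<k}. b i \<le> a (i + 1)"
  shows "(\<Prod>n=1..(\<Sum>i<k. b i * cf_denom a i). \<bar>2 * sin (pi * real n * \<alpha>)\<bar>)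
       \<le> (\<Prod>i<k. 2 ^ b i * real (cf_denom a i) ^ 3)"
  using b
proof (induction k)
  case (Suc k)
  let ?f = "\<lambda>n. \<bar>2 * sin (pi * real n * \<alpha>)\<bar>"
  let ?M = "\<Sum>i<k. b i * cf_denom a i" and ?N = "b k * cf_denom a k"
  have "(\<Prod>n=1..(\<Sum>i<Suc k. b i * cf_denom a i). ?f n) = (\<Prod>n=1..?M. ?f n) * (\<Prod>n=?M + 1..?M + ?N. ?f n)"
    using prod.ub_add_nat[of 1 ?M ?f ?N] by simp
  also have "(\<Prod>n=?M + 1..?M + ?N. ?f n) = (\<Prod>n=1..?N. ?f (?M + n))"
    using prod.shift_bounds_cl_nat_ivl[of ?f 1 ?M ?N] by (simp add: add_ac)
  also have "(\<Prod>n=1..?M. ?f n) * \<dots>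
      \<le> (\<Prod>i<k. 2 ^ b i * real (cf_denom a i) ^ 3) * (2 ^ b k * real (cf_denom a k) ^ 3)"
  proof (intro mult_mono)
    show "(\<Prod>n=1..?M. ?f n) \<le> (\<Prod>i<k. 2 ^ b i * real (cf_denom a i) ^ 3)"
      using Suc by simp
    show "(\<Prod>n=1..?N. ?f (?M + n)) \<le> 2 ^ b k * real (cf_denom a k) ^ 3"
      using Suc.prems by (intro prod_sin_level_le[OF irr cf]) auto
  qed (auto intro: prod_nonneg)
  finally show ?case by simp
qed simp

theorem theorem4:
  fixes \<alpha> :: real and a b :: "nat \<Rightarrow> nat" and N l :: nat
  assumes "\<alpha> \<in> {0..1}" and "\<alpha> \<notin> \<rat>"
    and "is_cf_expansion a \<alpha>"
    and "N \<ge> 1"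
    and "cf_denom a l \<le> N" and "N < cf_denom a (l + 1)"
    and "is_ostrowski_expansion a N l b"
  shows "(\<Prod>n=1..N. \<bar>2 * sin (pi * real n * \<alpha>)\<bar>)
           \<le> (\<Prod>i=0..l. 2 ^ b i * real (cf_denom a i) ^ 3)"
proof -
  have "\<forall>i\<in>{1..<Suc l}. b i \<le> a (i + 1)" and "N = (\<Sum>i<Suc l. b i * cf_denom a i)"
    using assms(7) by (auto simp: is_ostrowski_expansion_def atLeast0AtMost lessThan_Suc_atMost)
  then show ?thesis
    using prod_sin_digits_le[OF assms(2,3), of "Suc l" b]
    by (simp add: atLeast0AtMost lessThan_Suc_atMost)
qed

end
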